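(* Let $\mathbb{P}$ be an $\omega$-poset, let $\mathbb{Q}$ be a poset, and let $\phi:\mathsf{S}\mathbb{P}\to\mathsf{S}\mathbb{Q}$ be a continuous map between their spectra. Then \[q\sqsupset_\phi p\quad\Leftrightarrow\quad\phi^{-1}[q^\in]\supseteq p^\in\qquad(q\in\mathbb{Q},\ p\in\mathbb{P})\] defines a refiner $\sqsupset_\phi\ \subseteq\mathbb{Q}\times\mathbb{P}$ such that, for every $S\in\mathsf{S}\mathbb{P}$, \[\{q\in\mathbb{Q}:\exists p\in S\ (q\sqsupset_\phi p)\}=\phi(S).\]
   Context: Let $(\mathbb{P},\leq)$ be a poset. A subset $S\subseteq\mathbb{P}$ refines $T\subseteq\mathbb{P}$ if for every $s\in S$ there is $t\in T$ with $s\leq t$. A band of $\mathbb{P}$ is a finite subset $B\subseteq\mathbb{P}$ such that every $p\in\mathbb{P}$ is comparable to some $b\in B$. A cap of $\mathbb{P}$ is a subset refined by some band. A selector is a subset $S\subseteq\mathbb{P}$ with $S\cap C\neq\emptyset$ for every cap $C$ of $\mathbb{P}$; a minimal selector is one minimal with respect to inclusion among all selectors. The spectrum $\mathsf{S}\mathbb{P}$ is the set of all minimal selectors, with the topology generated by the subbasis consisting of the sets $p^\in=\{S\in\mathsf{S}\mathbb{P}:p\in S\}$, for $p\in\mathbb{P}$. $\mathbb{P}$ is an $\omega$-poset if every principal filter $p^\leq=\{q\in\mathbb{P}:p\leq q\}$ is finite and, for each $n\in\omega$, the number of principal filters of size $n$ is finite. A relation $\sqsupset\ \subseteq\mathbb{Q}\times\mathbb{P}$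 between posets is a refiner if for every cap $D$ of $\mathbb{Q}$ there is a cap $C$ of $\mathbb{P}$ such that for every $c\in C$ there is $d\in D$ with $d\sqsupset c$. *)

theory Defs
  imports "HOL-Analysis.Analysis"
begin

text \<open>
  A poset is a carrier set \<open>P\<close> (possibly empty) with a relation \<open>r\<close> such that
  \<open>partial_order_on P r\<close>; the pair \<open>(x, y) \<in> r\<close> stands for \<open>x \<le> y\<close>.
\<close>

definition refines :: "'a rel \<Rightarrow> 'a set \<Rightarrow> 'a set \<Rightarrow> bool" where
  "refines r S T \<longleftrightarrow> (\<forall>s\<in>S. \<exists>t\<in>T. (s, t) \<in> r)"

definition band :: "'a set \<Rightarrow> 'a rel \<Rightarrow> 'a set \<Rightarrow> bool" where
  "band P r B \<longleftrightarrow> finite B \<and> B \<subseteq> P \<and> (\<forall>p\<in>P. \<exists>b\<in>B. (p, b) \<in> r \<or> (b, p) \<in> r)"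

definition cap :: "'a set \<Rightarrow> 'a rel \<Rightarrow> 'a set \<Rightarrow> bool" where
  "cap P r C \<longleftrightarrow> C \<subseteq> P \<and> (\<exists>B. band P r B \<and> refines r B C)"

definition selector :: "'a set \<Rightarrow> 'a rel \<Rightarrow> 'a set \<Rightarrow> bool" where
  "selector P r S \<longleftrightarrow> S \<subseteq> P \<and> (\<forall>C. cap P r C \<longrightarrow> S \<inter> C \<noteq> {})"

definition minimal_selector :: "'a set \<Rightarrow> 'a rel \<Rightarrow> 'a set \<Rightarrow> bool" where
  "minimal_selector P r S \<longleftrightarrow> selector P r S \<and> (\<forall>T. selector P r T \<and> T \<subseteq> S \<longrightarrow> T = S)"

definition spectrum :: "'a set \<Rightarrow> 'a rel \<Rightarrow> 'a set set" where
  "spectrum P r = {S. minimal_selector P r S}"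

definition spectrum_subbasic :: "'a set \<Rightarrow> 'a rel \<Rightarrow> 'a \<Rightarrow> 'a set set" where
  "spectrum_subbasic P r p = {S \<in> spectrum P r. p \<in> S}"

text \<open>
  The empty intersection is read as the whole spectrum, so the latter is open even when the
  subbasic sets do not cover it. This happens if the poset has no bands: then there are no caps,
  and the empty set is the only minimal selector.
\<close>

definition spectrum_topology :: "'a set \<Rightarrow> 'a rel \<Rightarrow> 'a set topology" where
  "spectrum_topology P r =
     topology (arbitrary union_of
       (finite intersection_of (\<lambda>U. U \<in> spectrum_subbasic P r ` P) relative_to spectrum P r))"

definition principal_filter :: "'a set \<Rightarrow> 'a rel \<Rightarrow> 'a \<Rightarrow> 'a set" where
  "principal_filter P r p = {q \<in> P. (p, q) \<in> r}"

definition omega_poset :: "'a set \<Rightarrow> 'a rel \<Rightarrow> bool" where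
  "omega_poset P r \<longleftrightarrow> partial_order_on P r
     \<and> (\<forall>p\<in>P. finite (principal_filter P r p))
     \<and> (\<forall>n. finite {F \<in> principal_filter P r ` P. card F = n})"

text \<open>
  A relation between \<open>Q\<close> and \<open>P\<close> contains the pair \<open>(q, p)\<close> when \<open>q \<sqsupset> p\<close>.
\<close>

definition refiner :: "'b set \<Rightarrow> 'b rel \<Rightarrow> 'a set \<Rightarrow> 'a rel \<Rightarrow> ('b \<times> 'a) set \<Rightarrow> bool" where
  "refiner Q s P r R \<longleftrightarrow> R \<subseteq> Q \<times> P
     \<and> (\<forall>D. cap Q s D \<longrightarrow> (\<exists>C. cap P r C \<and> (\<forall>c\<in>C. \<exists>d\<in>D. (d, c) \<in> R)))"

text \<open>
  Maps between spectra are total functions on the ambient types, hence the restriction of the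
  preimage to \<open>spectrum P r\<close>.
\<close>

definition induced_relation ::
  "'a set \<Rightarrow> 'a rel \<Rightarrow> 'b set \<Rightarrow> 'b rel \<Rightarrow> ('a set \<Rightarrow> 'b set) \<Rightarrow> ('b \<times> 'a) set" where
  "induced_relation P r Q s \<phi> = {(q, p). q \<in> Q \<and> p \<in> P \<and>
     \<phi> -` spectrum_subbasic Q s q \<inter> spectrum P r \<supseteq> spectrum_subbasic P r p}"

end

theory Submission
  imports Defs
begin

text \<open>
  A set \<open>C\<close> that meets every minimal selector is a cap: otherwise the complement of \<open>C\<close> meets every
  cap, so it is a selector, and a minimal selector inside it avoids \<open>C\<close>
  (\<open>cap_if_meets_spectrum\<close>). This reduces the refiner property to the equation for \<open>\<phi> S\<close>.
  Given a cap \<open>D\<close> of \<open>Q\<close>, let \<open>C\<close> consist of the elements related to a member of \<open>D\<close>. For each \<open>S\<close>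
  in the spectrum of \<open>P\<close> the minimal selector \<open>\<phi> S\<close> contains some \<open>d \<in> D\<close>, and the equation yields
  some \<open>p \<in> S\<close> related to \<open>d\<close>; hence \<open>C\<close> meets \<open>S\<close>.

  In the equation, the members of the left-hand side lie in \<open>\<phi> S\<close> by definition of the relation.
  Conversely, if \<open>q \<in> \<phi> S\<close>, then continuity makes the preimage of the subbasic set of \<open>q\<close> an open
  neighbourhood of \<open>S\<close>. What is needed is a single \<open>p \<in> S\<close> whose subbasic set fits inside that
  neighbourhood, that is, the subbasis must be a basis (\<open>spectrum_subbasic_local_base\<close>). Since
  minimal selectors are upward closed, it is enough that any two elements \<open>k\<close>, \<open>l\<close> of \<open>S\<close> have a
  common lower bound in \<open>S\<close>. By minimality there are caps \<open>C\<close> and \<open>D\<close> that meet \<open>S\<close> only in \<open>k\<close> and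
  in \<open>l\<close>; an element of \<open>S\<close> in a band refining both \<open>C\<close> and \<open>D\<close> is such a bound.

  The common refinement exists because \<open>P\<close> is an \<open>\<omega>\<close>-poset: it has bands whose elements lie
  strictly above no element of a given finite set (\<open>omega_poset_band_not_above\<close>).
\<close>

section \<open>Caps and selectors\<close>

lemma cap_superset:
  assumes "cap P r C" "C \<subseteq> D" "D \<subseteq> P"
  shows "cap P r D"
  using assms unfolding cap_def refines_def by blast

lemma cap_refines_cap:
  assumes "partial_order_on P r" "cap P r C" "refines r C D" "D \<subseteq> P"
  shows "cap P r D"
proof -
  have "trans r"
    using assms(1) by (simp add: partial_order_on_def preorder_on_def)
  then show ?thesis
    using assms(2-4) unfolding cap_def refines_def by (meson transD)
qed

lemma cap_contains_finite_cap:
  assumes "cap P r C"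
  obtains C' where "C' \<subseteq> C" "finite C'" "cap P r C'"
proof -
  obtain B where B: "band P r B" "refines r B C" and "C \<subseteq> P"
    using assms by (auto simp: cap_def)
  then obtain f where f: "\<forall>b\<in>B. f b \<in> C \<and> (b, f b) \<in> r"
    unfolding refines_def by metis
  have "finite (f ` B)"
    using B(1) by (simp add: band_def)
  moreover have "cap P r (f ` B)"
    using f B(1) \<open>C \<subseteq> P\<close> unfolding cap_def refines_def by blast
  ultimately show ?thesis
    using that f by blast
qed

text \<open>
  Zorn's lemma applies to selectors ordered by reverse inclusion because every cap contains a
  finite one: if the intersection of a chain missed a finite cap, a single member would miss it.
\<close>

lemma selector_contains_minimal_selector:
  assumes "selector P r S"
  obtains M where "minimal_selector P r M" "M \<subseteq> S"
proof -
  define A where "A = {T. selector P r T \<and> T \<subseteq> S}"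
  have "\<exists>M\<in>A. \<forall>T\<in>A. T \<subseteq> M \<longrightarrow> T = M"
  proof (rule predicate_Zorn[where P = "\<lambda>X Y. Y \<subseteq> X", simplified])
    show "partial_order_on A (relation_of (\<lambda>X Y. Y \<subseteq> X) A)"
      by (auto simp: partial_order_on_def preorder_on_def relation_of_def
          intro!: refl_onI transI antisymI)
  next
    fix K assume "K \<in> Chains (relation_of (\<lambda>X Y. Y \<subseteq> X) A)"
    then have sub: "K \<subseteq> A" and chain: "\<And>X Y. X \<in> K \<Longrightarrow> Y \<in> K \<Longrightarrow> X \<subseteq> Y \<or> Y \<subseteq> X"
      by (auto simp: Chains_def relation_of_def)
    show "\<exists>M\<in>A. \<forall>T\<in>K. M \<subseteq> T"
    proof (cases "K = {}")
      case True
      then show ?thesis using assms A_def by auto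
    next
      case False
      have "\<Inter>K \<inter> C \<noteq> {}" if "cap P r C" for C
      proof
        assume empty: "\<Inter>K \<inter> C = {}"
        obtain C' where C': "C' \<subseteq> C" "finite C'" "cap P r C'"
          using cap_contains_finite_cap \<open>cap P r C\<close> .
        \<comment> \<open>The complements of the members of \<open>K\<close> form a chain that covers the finite set \<open>C'\<close>.\<close>
        have "C' \<subseteq> \<Union>((\<lambda>X. - X) ` K)"
          using empty C'(1) by blast
        moreover have "subset.chain UNIV ((\<lambda>X. - X) ` K)"
          using chain by (fastforce simp: subset_chain_def)
        ultimately obtain X where "X \<in> K" "C' \<subseteq> - X"
          using finite_subset_Union_chain[OF C'(2)] False
          by (smt (verit) image_iff image_is_empty)
        moreover have "X \<inter> C' \<noteq> {}"
          using \<open>X \<in> K\<close> sub C'(3) by (auto simp: A_def selector_def)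
        ultimately show False by blast
      qed
      moreover have "\<Inter>K \<subseteq> S" "\<Inter>K \<subseteq> P"
        using False sub unfolding A_def selector_def by blast+
      ultimately show ?thesis
        unfolding A_def selector_def by blast
    qed
  qed
  then obtain M where M: "M \<in> A" "\<And>T. T \<in> A \<Longrightarrow> T \<subseteq> M \<Longrightarrow> T = M"
    by blast
  have "minimal_selector P r M"
    unfolding minimal_selector_def
  proof (intro conjI allI impI)
    show "selector P r M"
      using M(1) by (simp add: A_def)
    fix T assume "selector P r T \<and> T \<subseteq> M"
    then show "T = M"
      using M(1) by (intro M(2)) (auto simp: A_def)
  qed
  moreover have "M \<subseteq> S"
    using M(1) by (simp add: A_def)
  ultimately show ?thesis
    by (rule that)
qed

text \<open>
  A cap inside \<open>C\<close> would make \<open>C\<close> a cap. So if \<open>C\<close> is not a cap, then \<open>P - C\<close> is a selector, and it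
  contains a minimal one.
\<close>

lemma cap_if_meets_spectrum:
  assumes "C \<subseteq> P" "\<And>S. S \<in> spectrum P r \<Longrightarrow> S \<inter> C \<noteq> {}"
  shows "cap P r C"
proof (rule ccontr)
  assume "\<not> cap P r C"
  have "(P - C) \<inter> D \<noteq> {}" if "cap P r D" for D
  proof -
    have "\<not> D \<subseteq> C"
      using \<open>\<not> cap P r C\<close> cap_superset[OF that] assms(1) by blast
    moreover have "D \<subseteq> P"
      using that by (simp add: cap_def)
    ultimately show ?thesis by blast
  qed
  then have "selector P r (P - C)"
    by (auto simp: selector_def)
  then obtain M where "minimal_selector P r M" "M \<subseteq> P - C"
    by (rule selector_contains_minimal_selector)
  then show False
    using assms(2) by (auto simp: spectrum_def)
qed

text \<open>
  Such a cap witnesses that \<open>p\<close> cannot be removed from \<open>S\<close>. It is the form in which minimality is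
  used below: any element of \<open>S\<close> found in this cap must be \<open>p\<close>.
\<close>

lemma minimal_selector_private_cap:
  assumes "minimal_selector P r S" "p \<in> S"
  obtains C where "cap P r C" "S \<inter> C = {p}"
proof -
  have "\<not> selector P r (S - {p})"
    using assms by (auto simp: minimal_selector_def)
  moreover have S: "selector P r S"
    using assms(1) by (simp add: minimal_selector_def)
  ultimately obtain C where C: "cap P r C" "(S - {p}) \<inter> C = {}"
    unfolding selector_def by blast
  moreover have "S \<inter> C \<noteq> {}"
    using S C(1) by (simp add: selector_def)
  ultimately show ?thesis
    using that by blast
qed

text \<open>
  Replacing \<open>p\<close> by the larger \<open>q\<close> in a cap that meets \<open>S\<close> only in \<open>p\<close> gives another cap, which \<open>S\<close>
  can meet only in \<open>q\<close>.
\<close>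

lemma minimal_selector_upward_closed:
  assumes "partial_order_on P r" "minimal_selector P r S"
    and "p \<in> S" "(p, q) \<in> r" "q \<in> P"
  shows "q \<in> S"
proof -
  obtain C where C: "cap P r C" "S \<inter> C = {p}"
    using minimal_selector_private_cap[OF assms(2,3)] .
  have "C \<subseteq> P"
    using C(1) by (simp add: cap_def)
  have "refines r C (insert q (C - {p}))"
    using \<open>C \<subseteq> P\<close> assms(1,4)
    by (auto simp: refines_def partial_order_on_def preorder_on_def refl_on_def)
  then have "cap P r (insert q (C - {p}))"
    using cap_refines_cap[OF assms(1) C(1)] \<open>C \<subseteq> P\<close> assms(5) by blast
  then have "S \<inter> insert q (C - {p}) \<noteq> {}"
    using assms(2) unfolding minimal_selector_def selector_def by blast
  then show ?thesis
    using C(2) by blast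
qed

section \<open>Bands of \<open>\<omega>\<close>-posets\<close>

lemma finite_subset_has_minimal_below:
  assumes "partial_order_on P r" "finite G" "G \<subseteq> P" "p \<in> G"
  shows "\<exists>m\<in>G. (m, p) \<in> r \<and> (\<forall>g\<in>G. (g, m) \<in> r \<longrightarrow> g = m)"
proof -
  have po: "trans r" "antisym r" "refl_on P r"
    using assms(1) by (auto simp: partial_order_on_def preorder_on_def)
  let ?H = "{g \<in> G. (g, p) \<in> r}"
  let ?less = "\<lambda>x y. (x, y) \<in> r \<and> x \<noteq> y"
  have "asymp_on ?H ?less"
    using po(2) by (auto intro!: asymp_onI dest: antisymD)
  moreover have "transp_on ?H ?less"
    using po(1,2) by (intro transp_onI) (metis antisymD transD)
  moreover have "?H \<noteq> {}"
    using assms(3,4) po(3) by (auto intro: refl_onD)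
  ultimately obtain m where m: "m \<in> ?H" "\<forall>g\<in>?H. g \<noteq> m \<longrightarrow> \<not> ?less g m"
    using Finite_Set.bex_min_element[of ?H ?less] assms(2) by auto
  have "g = m" if "g \<in> G" "(g, m) \<in> r" for g
    using transD[OF po(1) that(2)] m that by blast
  then show ?thesis
    using m(1) by blast
qed

text \<open>
  By antisymmetry an element is determined by its principal filter, so the bound on the number of
  filters of each size bounds the number of elements.
\<close>

lemma omega_poset_finite_elements_bounded_filter:
  assumes "omega_poset P r"
  shows "finite {p \<in> P. card (principal_filter P r p) \<le> n}"
proof -
  let ?F = "principal_filter P r"
  have po: "antisym r" "refl_on P r"
    using assms by (auto simp: omega_poset_def partial_order_on_def preorder_on_def)
  have "inj_on ?F P"
    using po by (auto simp: inj_on_def principal_filter_def refl_on_def dest: antisymD)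
  have "?F ` {p \<in> P. card (?F p) \<le> n} \<subseteq> (\<Union>k\<in>{..n}. {F \<in> ?F ` P. card F = k})"
    by auto
  moreover have "finite (\<Union>k\<in>{..n}. {F \<in> ?F ` P. card F = k})"
    using assms by (simp add: omega_poset_def)
  ultimately have "finite (?F ` {p \<in> P. card (?F p) \<le> n})"
    by (rule finite_subset)
  moreover have "inj_on ?F {p \<in> P. card (?F p) \<le> n}"
    using \<open>inj_on ?F P\<close> by (rule inj_on_subset) auto
  ultimately show ?thesis
    by (rule finite_imageD)
qed

text \<open>
  Let \<open>G\<close> be the upward closure of \<open>F\<close>, which is finite. The band consists of the minimal elements of
  \<open>G\<close> and the maximal elements of \<open>P - G\<close>. An element of \<open>G\<close> is above one of the former. An element
  of \<open>P - G\<close> is below one of the latter, its principal filter being finite. There are only finitely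
  many of the latter, since the principal filter of each has at most one element outside \<open>G\<close>.
\<close>

lemma omega_poset_band_not_above:
  assumes "omega_poset P r" "finite F" "F \<subseteq> P"
  obtains L where "band P r L"
    "\<And>l f. l \<in> L \<Longrightarrow> f \<in> F \<Longrightarrow> (f, l) \<in> r \<Longrightarrow> f = l"
proof -
  have order: "partial_order_on P r"
    and fin: "\<And>p. p \<in> P \<Longrightarrow> finite (principal_filter P r p)"
    using assms(1) by (auto simp: omega_poset_def)
  have po: "trans r" "antisym r" "refl_on P r"
    using order by (auto simp: partial_order_on_def preorder_on_def)
  define G where "G = (\<Union>f\<in>F. principal_filter P r f)"
  have G: "finite G" "G \<subseteq> P" "F \<subseteq> G"
    using assms(2,3) fin po(3) by (auto simp: G_def principal_filter_def refl_on_def)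
  have up: "q \<in> G" if "p \<in> G" "(p, q) \<in> r" "q \<in> P" for p q
    using that(1,3) transD[OF po(1) _ that(2)] by (auto simp: G_def principal_filter_def)
  define L1 where "L1 = {m \<in> G. \<forall>g\<in>G. (g, m) \<in> r \<longrightarrow> g = m}"
  define L2 where "L2 = {m \<in> P - G. \<forall>q\<in>P - G. (m, q) \<in> r \<longrightarrow> q = m}"
  have "L2 \<subseteq> {p \<in> P. card (principal_filter P r p) \<le> Suc (card G)}"
  proof
    fix m assume m: "m \<in> L2"
    have "principal_filter P r m \<subseteq> insert m G"
      using m by (auto simp: L2_def principal_filter_def)
    then have "card (principal_filter P r m) \<le> card (insert m G)"
      using G(1) by (intro card_mono) auto
    also have "\<dots> \<le> Suc (card G)"
      using G(1) by (simp add: card_insert_if)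
    finally show "m \<in> {p \<in> P. card (principal_filter P r p) \<le> Suc (card G)}"
      using m by (auto simp: L2_def)
  qed
  then have "finite L2"
    using omega_poset_finite_elements_bounded_filter[OF assms(1)] by (rule finite_subset)
  have "\<exists>b\<in>L1 \<union> L2. (p, b) \<in> r \<or> (b, p) \<in> r" if "p \<in> P" for p
  proof (cases "p \<in> G")
    case True
    show ?thesis
      using finite_subset_has_minimal_below[OF order G(1,2) True]
      unfolding L1_def by blast
  next
    case False
    \<comment> \<open>A maximal element of \<open>?H\<close> above \<open>p\<close>, obtained as a minimal one for the converse order.\<close>
    let ?H = "principal_filter P r p - G"
    have "p \<in> ?H"
      using False that po(3) by (auto simp: principal_filter_def refl_on_def)
    moreover have "partial_order_on P (r\<inverse>)"
      using order by simp
    moreover have "finite ?H" "?H \<subseteq> P"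
      using fin[OF \<open>p \<in> P\<close>] by (auto simp: principal_filter_def)
    ultimately obtain m where m: "m \<in> ?H" "(m, p) \<in> r\<inverse>"
      "\<forall>h\<in>?H. (h, m) \<in> r\<inverse> \<longrightarrow> h = m"
      using finite_subset_has_minimal_below[of P "r\<inverse>" ?H p] by blast
    have "m \<in> L2"
      unfolding L2_def using m transD[OF po(1), of p m] by (auto simp: principal_filter_def)
    then show ?thesis
      using m(2) by auto
  qed
  then have "band P r (L1 \<union> L2)"
    using \<open>finite L2\<close> G(1,2) by (auto simp: band_def L1_def L2_def)
  moreover have "f = l" if "l \<in> L1 \<union> L2" "f \<in> F" "(f, l) \<in> r" for l f
    using that G(3) up by (auto simp: L1_def L2_def)
  ultimately show ?thesis
    using that by blast
qed

text \<open>
  A band none of whose elements is strictly above an element of the band \<open>A\<close> refines \<open>A\<close>, because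
  its elements are comparable to elements of \<open>A\<close>. The union of the bands below the two caps is
  finite, so one band refines both.
\<close>

lemma omega_poset_caps_common_refinement:
  assumes "omega_poset P r" "cap P r C" "cap P r D"
  obtains L where "band P r L" "refines r L C" "refines r L D"
proof -
  have "trans r"
    using assms(1) by (auto simp: omega_poset_def partial_order_on_def preorder_on_def)
  obtain A B where A: "band P r A" "refines r A C" and B: "band P r B" "refines r B D"
    using assms(2,3) by (auto simp: cap_def)
  obtain L where L: "band P r L"
    "\<And>l f. l \<in> L \<Longrightarrow> f \<in> A \<union> B \<Longrightarrow> (f, l) \<in> r \<Longrightarrow> f = l"
    using omega_poset_band_not_above[OF assms(1), of "A \<union> B"] A(1) B(1)
    by (auto simp: band_def)
  have "refines r L E" if A': "band P r A'" "refines r A' E" "A' \<subseteq> A \<union> B" for A' E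
    unfolding refines_def
  proof
    fix l assume "l \<in> L"
    then have "l \<in> P"
      using L(1) by (auto simp: band_def)
    then obtain a where a: "a \<in> A'" "(l, a) \<in> r \<or> (a, l) \<in> r"
      using A'(1) by (auto simp: band_def)
    then have "(l, a) \<in> r"
      using L(2)[OF \<open>l \<in> L\<close>] A'(3) by blast
    then show "\<exists>e\<in>E. (l, e) \<in> r"
      using A'(2) a(1) \<open>trans r\<close> unfolding refines_def by (meson transD)
  qed
  then show ?thesis
    using that L(1) A B by blast
qed

section \<open>The topology of the spectrum\<close>

lemma topspace_spectrum_topology: "topspace (spectrum_topology P r) = spectrum P r"
  by (simp add: spectrum_topology_def)

lemma openin_spectrum_subbasic:
  assumes "p \<in> P"
  shows "openin (spectrum_topology P r) (spectrum_subbasic P r p)"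
proof -
  have "spectrum_subbasic P r p = spectrum P r \<inter> spectrum_subbasic P r p"
    by (auto simp: spectrum_subbasic_def)
  moreover have "(finite intersection_of (\<lambda>U. U \<in> spectrum_subbasic P r ` P))
      (spectrum_subbasic P r p)"
    using assms by (intro finite_intersection_of_inc) auto
  ultimately have "(finite intersection_of (\<lambda>U. U \<in> spectrum_subbasic P r ` P)
      relative_to spectrum P r) (spectrum_subbasic P r p)"
    by (metis relative_to_inc)
  then show ?thesis
    unfolding spectrum_topology_def openin_subbase by (rule arbitrary_union_of_inc)
qed

text \<open>
  With upward closure this says that minimal selectors are filters. For \<open>K = {}\<close> it says that they
  are nonempty, which needs a band to exist.
\<close>

lemma minimal_selector_filter_base:
  assumes "omega_poset P r" "minimal_selector P r S" "finite K" "K \<subseteq> S"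
  shows "\<exists>p\<in>S. \<forall>k\<in>K. (p, k) \<in> r"
proof -
  have order: "partial_order_on P r"
    using assms(1) by (simp add: omega_poset_def)
  have refl: "refl_on P r" and trans: "trans r"
    using order by (auto simp: partial_order_on_def preorder_on_def)
  have sel: "S \<subseteq> P" "\<And>C. cap P r C \<Longrightarrow> S \<inter> C \<noteq> {}"
    using assms(2) by (auto simp: minimal_selector_def selector_def)
  have band_cap: "cap P r L" if "band P r L" for L
    using that refl unfolding cap_def refines_def band_def refl_on_def by blast
  show ?thesis
    using assms(3,4)
  proof (induction K)
    case empty
    obtain L where "band P r L"
      using omega_poset_band_not_above[OF assms(1), of "{}"] by auto
    then show ?case
      using sel(2) band_cap by fastforce
  next
    case (insert k K)
    then obtain q where q: "q \<in> S" "\<forall>k\<in>K. (q, k) \<in> r"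
      by auto
    have "k \<in> S"
      using insert.prems by simp
    obtain C where C: "cap P r C" "S \<inter> C = {k}"
      using minimal_selector_private_cap[OF assms(2) \<open>k \<in> S\<close>] .
    obtain D where D: "cap P r D" "S \<inter> D = {q}"
      using minimal_selector_private_cap[OF assms(2) q(1)] .
    obtain L where L: "band P r L" "refines r L C" "refines r L D"
      using omega_poset_caps_common_refinement[OF assms(1) C(1) D(1)] .
    obtain p where p: "p \<in> S" "p \<in> L"
      using sel(2)[OF band_cap[OF L(1)]] by blast
    have below: "(p, e) \<in> r" if "cap P r E" "S \<inter> E = {e}" "refines r L E" for E e
    proof -
      obtain x where x: "x \<in> E" "(p, x) \<in> r"
        using \<open>refines r L E\<close> p(2) by (auto simp: refines_def)
      moreover have "x \<in> P"
        using x(1) \<open>cap P r E\<close> by (auto simp: cap_def)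
      ultimately have "x \<in> S"
        using minimal_selector_upward_closed[OF order assms(2) p(1)] by blast
      then have "x = e"
        using x(1) \<open>S \<inter> E = {e}\<close> by blast
      then show ?thesis
        using x(2) by simp
    qed
    have "(p, k) \<in> r" "(p, q) \<in> r"
      using below C D L by blast+
    then show ?case
      using p(1) q(2) transD[OF trans \<open>(p, q) \<in> r\<close>] by auto
  qed
qed

text \<open>
  A basic neighbourhood of \<open>S\<close> is given by a finite \<open>K \<subseteq> S\<close>. For a lower bound \<open>p \<in> S\<close> of \<open>K\<close>, every
  minimal selector that contains \<open>p\<close> contains \<open>K\<close>.
\<close>

lemma spectrum_subbasic_local_base:
  assumes "omega_poset P r" "openin (spectrum_topology P r) U" "S \<in> U"
  obtains p where "p \<in> S" "spectrum_subbasic P r p \<subseteq> U"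
proof -
  have order: "partial_order_on P r"
    using assms(1) by (simp add: omega_poset_def)
  have S: "minimal_selector P r S"
    using openin_subset[OF assms(2)] assms(3) topspace_spectrum_topology
    by (auto simp: spectrum_def)
  obtain X where X: "S \<in> X" "X \<subseteq> U"
    "(finite intersection_of (\<lambda>U. U \<in> spectrum_subbasic P r ` P) relative_to spectrum P r) X"
    using assms(2,3) unfolding spectrum_topology_def openin_subbase arbitrary_union_of_alt
    by blast
  then obtain Y where Y: "X = spectrum P r \<inter> Y"
    "(finite intersection_of (\<lambda>U. U \<in> spectrum_subbasic P r ` P)) Y"
    unfolding relative_to_def by auto
  then obtain \<F> where \<F>: "finite \<F>" "\<F> \<subseteq> spectrum_subbasic P r ` P" "Y = \<Inter>\<F>"
    unfolding intersection_of_def by auto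
  obtain K where K: "K \<subseteq> P" "finite K" "\<F> = spectrum_subbasic P r ` K"
    using finite_subset_image[OF \<F>(1,2)] by blast
  have "K \<subseteq> S"
    using X(1) Y(1) \<F>(3) K(3) by (auto simp: spectrum_subbasic_def)
  obtain p where p: "p \<in> S" "\<forall>k\<in>K. (p, k) \<in> r"
    using minimal_selector_filter_base[OF assms(1) S K(2) \<open>K \<subseteq> S\<close>] by blast
  have "spectrum_subbasic P r p \<subseteq> X"
    unfolding Y(1) \<F>(3) using p(2) K minimal_selector_upward_closed[OF order]
    by (auto simp: spectrum_subbasic_def spectrum_def)
  then show ?thesis
    using that p(1) X(2) by blast
qed

section \<open>The refiner of a continuous map\<close>

theorem proposition3p2:
  fixes P :: "'a set" and r :: "'a rel"
    and Q :: "'b set" and s :: "'b rel"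
    and \<phi> :: "'a set \<Rightarrow> 'b set"
  assumes "omega_poset P r"
    and "partial_order_on Q s"
    and "continuous_map (spectrum_topology P r) (spectrum_topology Q s) \<phi>"
  shows "refiner Q s P r (induced_relation P r Q s \<phi>)
    \<and> (\<forall>S\<in>spectrum P r. {q \<in> Q. \<exists>p\<in>S. (q, p) \<in> induced_relation P r Q s \<phi>} = \<phi> S)"
proof -
  let ?R = "induced_relation P r Q s \<phi>"
  have recover: "{q \<in> Q. \<exists>p\<in>S. (q, p) \<in> ?R} = \<phi> S" if S: "S \<in> spectrum P r" for S
  proof
    show "{q \<in> Q. \<exists>p\<in>S. (q, p) \<in> ?R} \<subseteq> \<phi> S"
      using S by (auto simp: induced_relation_def spectrum_subbasic_def)
    have \<phi>S: "\<phi> S \<in> spectrum Q s"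
      using assms(3) S by (auto simp: continuous_map_def topspace_spectrum_topology)
    show "\<phi> S \<subseteq> {q \<in> Q. \<exists>p\<in>S. (q, p) \<in> ?R}"
    proof
      fix q assume q: "q \<in> \<phi> S"
      then have "q \<in> Q"
        using \<phi>S by (auto simp: spectrum_def minimal_selector_def selector_def)
      let ?U = "{T \<in> spectrum P r. \<phi> T \<in> spectrum_subbasic Q s q}"
      have "openin (spectrum_topology P r) ?U"
        using openin_continuous_map_preimage[OF assms(3) openin_spectrum_subbasic[OF \<open>q \<in> Q\<close>]]
        by (simp add: topspace_spectrum_topology)
      moreover have "S \<in> ?U"
        using S \<phi>S q by (simp add: spectrum_subbasic_def)
      ultimately obtain p where p: "p \<in> S" "spectrum_subbasic P r p \<subseteq> ?U"
        by (rule spectrum_subbasic_local_base[OF assms(1)])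
      moreover have "p \<in> P"
        using p(1) S by (auto simp: spectrum_def minimal_selector_def selector_def)
      ultimately have "(q, p) \<in> ?R"
        using \<open>q \<in> Q\<close> by (auto simp: induced_relation_def)
      then show "q \<in> {q \<in> Q. \<exists>p\<in>S. (q, p) \<in> ?R}"
        using p(1) \<open>q \<in> Q\<close> by blast
    qed
  qed
  have "\<exists>C. cap P r C \<and> (\<forall>c\<in>C. \<exists>d\<in>D. (d, c) \<in> ?R)" if D: "cap Q s D" for D
  proof (intro exI conjI)
    let ?C = "{p \<in> P. \<exists>d\<in>D. (d, p) \<in> ?R}"
    show "cap P r ?C"
    proof (rule cap_if_meets_spectrum)
      fix S assume S: "S \<in> spectrum P r"
      have "\<phi> S \<in> spectrum Q s"
        using assms(3) S by (auto simp: continuous_map_def topspace_spectrum_topology)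
      then have "selector Q s (\<phi> S)"
        by (simp add: spectrum_def minimal_selector_def)
      then obtain d where "d \<in> D" "d \<in> \<phi> S"
        using D unfolding selector_def by blast
      then obtain p where "p \<in> S" "(d, p) \<in> ?R"
        using recover[OF S] by blast
      then show "S \<inter> ?C \<noteq> {}"
        using \<open>d \<in> D\<close> by (auto simp: induced_relation_def)
    qed auto
  qed auto
  moreover have "?R \<subseteq> Q \<times> P"
    by (auto simp: induced_relation_def)
  ultimately have "refiner Q s P r ?R"
    unfolding refiner_def by blast
  then show ?thesis
    using recover by simp
qed

end
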